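(* There is an absolute constant $c > 0$ such that the following holds for all positive integers $m, n$. If $x_1, \ldots, x_m \in \mathbb{R}^n$ satisfy $\sum_{i=1}^m \|x_i\|_2^2 \le m$, then there exists $\varepsilon \in \{-1, 0, 1\}^n$ with $\|\varepsilon\|_1 \ge n/6$ and \[ \max_{i \in \{1, \ldots, m\}} |\langle \varepsilon, x_i\rangle| \le c\sqrt{\frac{m}{n}}. \]
   Context: $\|\cdot\|_2$ is the Euclidean norm, $\|\varepsilon\|_1=\sum_j|\varepsilon_j|$ (so for $\varepsilon\in\{-1,0,1\}^n$ it is the number of nonzero coordinates), and $\langle\cdot,\cdot\rangle$ is the standard inner product on $\mathbb{R}^n$. *)

theory Defs
  imports "HOL-Analysis.L2_Norm"
begin

text \<open>
  A vector in \<open>\<real>\<^sup>n\<close> is represented by a function of type \<^typ>\<open>nat \<Rightarrow> real\<close> of which only the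
  coordinates \<open>1, \<dots>, n\<close> are used, since the dimension is quantified inside the scope of the
  constant. The Euclidean norm of \<open>v\<close> is \<open>L2_set v {1..n}\<close>.
\<close>

definition l1_norm :: "nat \<Rightarrow> (nat \<Rightarrow> real) \<Rightarrow> real" where
  "l1_norm n v = (\<Sum>j = 1..n. \<bar>v j\<bar>)"

definition inner_prod :: "nat \<Rightarrow> (nat \<Rightarrow> real) \<Rightarrow> (nat \<Rightarrow> real) \<Rightarrow> real" where
  "inner_prod n u v = (\<Sum>j = 1..n. u j * v j)"

end

theory Submission
  imports Defs "HOL-Library.FuncSet"
begin

text \<open>
  The entropy method. Put \<open>\<delta> = 20 \<surd>(m/n)\<close> and send a sign vector \<open>e \<in> {-1,1}\<^sup>n\<close> to the integer
  vector with entries \<open>round (\<langle>e, x\<^sub>i\<rangle> / (2\<delta>))\<close>. By Gibbs' inequality against an explicit product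
  distribution, some fibre of this map has at least \<open>2\<^sup>n exp (-n/12)\<close> elements: the second and
  fourth moments of a Rademacher sum show that the \<open>i\<close>-th coordinate costs at most a constant times
  \<open>(\<parallel>x\<^sub>i\<parallel>\<^sup>2 + 1) / \<delta>\<^sup>2\<close>. The fourth moment is essential: with second moments alone a coordinate of small
  variance \<open>\<tau>\<close> would cost \<open>\<tau> ln (1/\<tau>)\<close>. Such a fibre is larger than a Hamming ball of radius
  \<open>n/6\<close>, so it contains two sign vectors at distance at least \<open>n/6\<close>, and \<open>\<epsilon>\<close> is half their
  difference.
\<close>

abbreviation signs :: "'a set \<Rightarrow> ('a \<Rightarrow> real) set" where
  "signs J \<equiv> J \<rightarrow>\<^sub>E {-1, 1}"

section \<open>Moments of Rademacher sums\<close>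

lemma sum_signs_insert:
  fixes f :: "('a \<Rightarrow> real) \<Rightarrow> real"
  assumes "finite J" "j \<notin> J"
  shows "(\<Sum>e\<in>signs (insert j J). f e) = (\<Sum>e\<in>signs J. f (e(j := 1)) + f (e(j := -1)))"
proof -
  have "(\<Sum>e\<in>signs (insert j J). f e) = (\<Sum>(y, g)\<in>{-1, 1} \<times> signs J. f (g(j := y)))"
    unfolding PiE_insert_eq
    using inj_combinator [OF assms(2), of "\<lambda>_. {-1, 1 :: real}"]
    by (simp add: sum.reindex case_prod_unfold)
  also have "\<dots> = (\<Sum>y\<in>{-1, 1::real}. \<Sum>g\<in>signs J. f (g(j := y)))"
    by (rule sum.cartesian_product [symmetric])
  also have "\<dots> = (\<Sum>e\<in>signs J. f (e(j := 1)) + f (e(j := -1)))"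
    by (simp add: sum.distrib)
  finally show ?thesis .
qed

lemma card_signs: "finite J \<Longrightarrow> card (signs J) = 2 ^ card J"
  by (simp add: card_PiE numeral_2_eq_2)

lemma sum_upd_notin:
  fixes v :: "'a \<Rightarrow> real"
  assumes "finite J" "j \<notin> J"
  shows "(\<Sum>k\<in>insert j J. (e(j := y)) k * v k) = y * v j + (\<Sum>k\<in>J. e k * v k)"
  using assms by (auto intro!: sum.cong)

text \<open>The cross terms of \<open>(a + b)^2\<close> and \<open>(a - b)^2\<close> cancel when the
  sign of the new coordinate is summed out.\<close>

lemma rademacher_second_moment:
  assumes "finite J"
  shows "(\<Sum>e\<in>signs J. (\<Sum>j\<in>J. e j * v j)\<^sup>2) = 2 ^ card J * (\<Sum>j\<in>J. (v j)\<^sup>2)"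
  using assms
proof (induction J rule: finite_induct)
  case (insert j J)
  have "(\<Sum>e\<in>signs (insert j J). (\<Sum>k\<in>insert j J. e k * v k)\<^sup>2)
      = (\<Sum>e\<in>signs J. 2 * (\<Sum>k\<in>J. e k * v k)\<^sup>2 + 2 * (v j)\<^sup>2)"
    by (simp only: sum_signs_insert [OF insert.hyps] sum_upd_notin [OF insert.hyps])
      (simp add: power2_eq_square algebra_simps)
  also have "\<dots> = 2 * (\<Sum>e\<in>signs J. (\<Sum>k\<in>J. e k * v k)\<^sup>2) + 2 * 2 ^ card J * (v j)\<^sup>2"
    using insert.hyps by (simp add: sum.distrib card_signs flip: sum_distrib_left)
  finally show ?case
    using insert by (simp add: algebra_simps)
qed simp

lemma rademacher_fourth_moment:
  assumes "finite J"
  shows "(\<Sum>e\<in>signs J. (\<Sum>j\<in>J. e j * v j) ^ 4) \<le> 2 ^ card J * (3 * (\<Sum>j\<in>J. (v j)\<^sup>2)\<^sup>2)"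
  using assms
proof (induction J rule: finite_induct)
  case (insert j J)
  let ?A = "\<Sum>k\<in>J. (v k)\<^sup>2"
  have ring: "(1 * b + a) ^ 4 + (-1 * b + a) ^ 4 = 2 * a ^ 4 + 12 * b\<^sup>2 * a\<^sup>2 + 2 * b ^ 4"
    for a b :: real
    by algebra
  have "(\<Sum>e\<in>signs (insert j J). (\<Sum>k\<in>insert j J. e k * v k) ^ 4)
      = (\<Sum>e\<in>signs J. 2 * (\<Sum>k\<in>J. e k * v k) ^ 4 + 12 * (v j)\<^sup>2 * (\<Sum>k\<in>J. e k * v k)\<^sup>2
          + 2 * (v j) ^ 4)"
    by (simp only: sum_signs_insert [OF insert.hyps] sum_upd_notin [OF insert.hyps] ring)
  also have "\<dots> = 2 * (\<Sum>e\<in>signs J. (\<Sum>k\<in>J. e k * v k) ^ 4)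
      + 12 * (v j)\<^sup>2 * (2 ^ card J * ?A) + 2 ^ card J * (2 * (v j) ^ 4)"
    using insert.hyps
    by (simp add: sum.distrib card_signs rademacher_second_moment flip: sum_distrib_left)
  \<comment> \<open>Raising the coefficient 2 of \<open>(v j) ^ 4\<close> to 6 completes the square:
    \<open>6 * A^2 + 12 * A * b^2 + 6 * b^4 = 6 * (A + b^2)^2\<close>.\<close>
  also have "\<dots> \<le> 2 * (2 ^ card J * (3 * ?A\<^sup>2))
      + 12 * (v j)\<^sup>2 * (2 ^ card J * ?A) + 2 ^ card J * (6 * (v j) ^ 4)"
    by (intro add_mono mult_left_mono insert.IH) auto
  also have "\<dots> = 2 ^ card (insert j J) * (3 * (\<Sum>k\<in>insert j J. (v k)\<^sup>2)\<^sup>2)"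
    using insert.hyps by (simp add: power2_eq_square power4_eq_xxxx algebra_simps)
  finally show ?case .
qed simp

section \<open>Large fibres from Gibbs' inequality\<close>

text \<open>The mean of \<open>- ln (Q (b e))\<close> is a cross entropy, so it is at least the
  entropy of \<open>b\<close> under the uniform distribution on \<open>S\<close>, which is the mean
  of \<open>ln (card S / fibre size)\<close>. If every fibre were smaller than
  \<open>card S * exp (- h)\<close>, that entropy would exceed \<open>h\<close>.\<close>

lemma ex_large_fibre:
  fixes Q :: "'b \<Rightarrow> real"
  assumes S: "finite S" "S \<noteq> {}"
    and pos: "\<And>e. e \<in> S \<Longrightarrow> Q (b e) > 0"
    and sub: "(\<Sum>y\<in>b ` S. Q y) \<le> 1"
    and cost: "(\<Sum>e\<in>S. - ln (Q (b e))) \<le> real (card S) * h"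
  shows "\<exists>e\<in>S. real (card S) * exp (- h) \<le> real (card {e' \<in> S. b e' = b e})"
proof (rule ccontr)
  assume neg: "\<not> ?thesis"
  define N where "N = real (card S)"
  define c where "c y = real (card {e' \<in> S. b e' = y})" for y
  have N: "N > 0"
    using S by (simp add: N_def card_gt_0_iff)
  have c: "c (b e) > 0" if "e \<in> S" for e
    using S that by (auto simp: c_def card_gt_0_iff)
  have small: "c (b e) < N * exp (- h)" if "e \<in> S" for e
    using neg that by (auto simp: N_def c_def not_le)
  have "(\<Sum>e\<in>S. ln (Q (b e)) + h) < (\<Sum>e\<in>S. Q (b e) * N / c (b e) - 1)"
  proof (rule sum_strict_mono [OF S])
    fix e assume e: "e \<in> S"
    have "ln (c (b e)) < ln (N * exp (- h))"
      using c [OF e] small [OF e] N by (subst ln_less_cancel_iff) auto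
    then have "ln (c (b e)) < ln N - h"
      using N by (simp add: ln_mult)
    then have "ln (Q (b e)) + h < ln (Q (b e) * N / c (b e))"
      using pos [OF e] c [OF e] N by (simp add: ln_mult ln_div)
    also have "\<dots> \<le> Q (b e) * N / c (b e) - 1"
      using pos [OF e] c [OF e] N by (intro ln_le_minus_one) auto
    finally show "ln (Q (b e)) + h < Q (b e) * N / c (b e) - 1" .
  qed
  also have "\<dots> = (\<Sum>e\<in>S. Q (b e) * N / c (b e)) - N"
    by (simp add: sum_subtractf N_def)
  \<comment> \<open>Grouping by fibres: the \<open>c y\<close> equal terms over \<open>y\<close> add
    up to \<open>Q y * N\<close>, so the total is at most \<open>N\<close>.\<close>
  also have "(\<Sum>e\<in>S. Q (b e) * N / c (b e))
      = (\<Sum>y\<in>b ` S. \<Sum>e\<in>{e \<in> S. b e = y}. Q (b e) * N / c (b e))"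
    using S(1) by (rule sum.image_gen)
  also have "\<dots> = (\<Sum>y\<in>b ` S. Q y * N)"
  proof (rule sum.cong [OF refl])
    fix y assume "y \<in> b ` S"
    then have "c y > 0"
      using c by auto
    have "(\<Sum>e\<in>{e \<in> S. b e = y}. Q (b e) * N / c (b e)) = (\<Sum>e\<in>{e \<in> S. b e = y}. Q y * N / c y)"
      by (rule sum.cong) auto
    also have "\<dots> = c y * (Q y * N / c y)"
      by (simp add: c_def)
    finally show "(\<Sum>e\<in>{e \<in> S. b e = y}. Q (b e) * N / c (b e)) = Q y * N"
      using \<open>c y > 0\<close> by simp
  qed
  also have "\<dots> = N * (\<Sum>y\<in>b ` S. Q y)"
    by (simp add: mult.commute flip: sum_distrib_left)
  also have "\<dots> - N \<le> 0"
    using mult_left_mono [OF sub, of N] N by simp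
  finally have "(\<Sum>e\<in>S. ln (Q (b e))) + N * h < 0"
    by (simp add: sum.distrib N_def)
  then show False
    using cost by (simp add: N_def sum_negf)
qed

text \<open>A probability distribution on the integers: mass \<open>\<eta>\<close> leaves 0 and is
  spread as a symmetric geometric law. The \<open>+ 1\<close> in the exponent splits the mass
  between the two signs.\<close>

definition geom_weight :: "real \<Rightarrow> int \<Rightarrow> real" where
  "geom_weight \<eta> k = (if k = 0 then 1 - \<eta> else \<eta> * (1 / 2) ^ (nat \<bar>k\<bar> + 1))"

lemma geom_weight_pos: "0 < \<eta> \<Longrightarrow> \<eta> < 1 \<Longrightarrow> geom_weight \<eta> k > 0"
  by (simp add: geom_weight_def)

lemma sum_geom_weight_le_1:
  assumes "0 < \<eta>"
  shows "(\<Sum>k\<in>{- int K..int K}. geom_weight \<eta> k) \<le> 1"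
proof -
  \<comment> \<open>The missing mass \<open>\<eta> * (1 / 2) ^ K\<close> is that of the two tails;
    keeping it exact lets the induction go through.\<close>
  have "(\<Sum>k\<in>{- int K..int K}. geom_weight \<eta> k) = 1 - \<eta> * (1 / 2) ^ K"
  proof (induction K)
    case (Suc K)
    have "{- int (Suc K)..int (Suc K)} = insert (- int (Suc K)) (insert (int (Suc K)) {- int K..int K})"
      by auto
    then show ?case
      using Suc by (simp add: geom_weight_def nat_add_distrib)
  qed (simp add: geom_weight_def)
  then show ?thesis
    using assms by simp
qed

text \<open>
  The nonzero values are paid for by \<open>16 s\<^sup>4 \<ge> 1\<close>, which turns the factor \<open>ln (1/\<tau>) \<le> 1/\<tau>\<close> into
  a quantity whose expectation is \<open>O(\<tau>)\<close> when \<open>s\<close> is a Rademacher sum of variance at most \<open>\<tau>\<close>.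
\<close>

lemma neg_ln_geom_weight_round_le:
  assumes "\<tau> > 0"
  shows "- ln (geom_weight (min (1 / 2) \<tau>) (round s)) \<le> 2 * \<tau> + 16 * s ^ 4 / \<tau> + 16 * s\<^sup>2"
proof (cases "round s = 0")
  case True
  define \<eta> where "\<eta> = min (1 / 2) \<tau>"
  have \<eta>: "0 < \<eta>" "\<eta> \<le> 1 / 2" "\<eta> \<le> \<tau>"
    using assms by (auto simp: \<eta>_def)
  have "- ln (1 - \<eta>) = ln (1 / (1 - \<eta>))"
    using \<eta> by (simp add: ln_div)
  also have "\<dots> \<le> 1 / (1 - \<eta>) - 1"
    using \<eta> by (intro ln_le_minus_one) auto
  also have "\<dots> \<le> 2 * \<eta>"
    using \<eta> mult_left_mono [of \<eta> "1 / 2" \<eta>] by (simp add: field_simps)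
  also have "\<dots> \<le> 2 * \<tau> + 16 * s ^ 4 / \<tau> + 16 * s\<^sup>2"
    using \<eta> assms by (simp add: add_increasing2)
  finally show ?thesis
    using True by (simp add: geom_weight_def \<eta>_def)
next
  case False
  define \<eta> where "\<eta> = min (1 / 2) \<tau>"
  define k where "k = nat \<bar>round s\<bar>"
  have \<eta>: "0 < \<eta>"
    using assms by (auto simp: \<eta>_def)
  have inv: "1 / \<eta> \<le> 2 + 1 / \<tau>"
    using assms by (auto simp: \<eta>_def min_def)
  have k1: "real k \<ge> 1"
    using False by (simp add: k_def)
  have "real k = \<bar>real_of_int (round s)\<bar>"
    by (simp add: k_def)
  then have "real k \<le> \<bar>s\<bar> + 1 / 2"
    using of_int_round_abs_le [of s] by linarith
  \<comment> \<open>A nonzero rounded value forces \<open>s\<close> away from 0, so constants can be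
    absorbed into \<open>4 * s^2\<close> or \<open>16 * s^4\<close>.\<close>
  then have s: "\<bar>s\<bar> \<ge> 1 / 2" "real k \<le> 2 * \<bar>s\<bar>"
    using k1 by auto
  have s1: "2 * \<bar>s\<bar> \<le> 4 * s\<^sup>2"
    using mult_right_mono [OF s(1), of "\<bar>s\<bar>"] by (simp add: power2_eq_square flip: abs_mult)
  then have s2: "1 \<le> 4 * s\<^sup>2"
    using s by linarith
  then have s4: "1 \<le> 16 * s ^ 4"
    using power_mono [OF s2, of 2] by (simp add: power_mult_distrib flip: power_mult)
  have "- ln (geom_weight \<eta> (round s)) = ln (1 / \<eta>) + real (k + 1) * ln 2"
    using False \<eta>
    by (simp add: geom_weight_def k_def ln_mult ln_div ln_realpow power_one_over algebra_simps
        del: power_Suc)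
  also have "\<dots> \<le> (1 / \<eta> - 1) + real (k + 1) * 1"
    using \<eta> ln_le_minus_one [of "2::real"]
    by (intro add_mono mult_left_mono ln_le_minus_one) auto
  also have "\<dots> \<le> 2 + 1 / \<tau> + 4 * s\<^sup>2"
    using inv s s1 by simp
  also have "1 / \<tau> \<le> 16 * s ^ 4 / \<tau>"
    using s4 assms by (simp add: divide_right_mono)
  \<comment> \<open>The remaining constant 2 is at most \<open>8 * s^2\<close>, which together with
    \<open>4 * s^2\<close> stays below \<open>16 * s^2\<close>.\<close>
  finally show ?thesis
    using s2 assms unfolding \<eta>_def by linarith
qed

section \<open>Hamming balls\<close>

text \<open>The weight factors over coordinates, and each coordinate contributes
  \<open>1 + 1 / 2\<close> whichever sign \<open>e0\<close> has there.\<close>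

lemma sum_half_power_hamming:
  assumes "finite J" "e0 \<in> signs J"
  shows "(\<Sum>e\<in>signs J. (1 / 2) ^ card {j \<in> J. e j \<noteq> e0 j}) = ((3 / 2) ^ card J :: real)"
proof -
  have "(\<Sum>e\<in>signs J. (1 / 2) ^ card {j \<in> J. e j \<noteq> e0 j})
      = (\<Sum>e\<in>signs J. \<Prod>j\<in>J. if e j \<noteq> e0 j then 1 / 2 else 1 :: real)"
    using assms(1) by (simp add: prod.If_cases Int_def)
  also have "\<dots> = (\<Prod>j\<in>J. \<Sum>y\<in>{-1, 1}. if y \<noteq> e0 j then 1 / 2 else 1)"
    using assms(1) by (subst prod_sum_PiE) auto
  also have "\<dots> = (\<Prod>j\<in>J. 3 / 2)"
    using assms(2) by (intro prod.cong) (auto simp: PiE_iff)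
  finally show ?thesis by simp
qed

text \<open>An exponential Markov bound: a point within distance \<open>r\<close> has weight at
  least \<open>2 powr (- r)\<close> in the sum of \<open>sum_half_power_hamming\<close>.\<close>

lemma card_hamming_ball_le:
  assumes J: "finite J" and e0: "e0 \<in> signs J" and T: "T \<subseteq> signs J"
    and close: "\<And>e. e \<in> T \<Longrightarrow> real (card {j \<in> J. e j \<noteq> e0 j}) \<le> r"
  shows "real (card T) \<le> 2 powr r * (3 / 2) ^ card J"
proof -
  let ?d = "\<lambda>e. card {j \<in> J. e j \<noteq> e0 j}"
  have fin: "finite (signs J)"
    using J by (simp add: finite_PiE)
  have "real (card T) = (\<Sum>e\<in>T. 1)"
    by simp
  also have "\<dots> \<le> (\<Sum>e\<in>T. 2 powr r * (1 / 2) ^ ?d e)"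
  proof (rule sum_mono)
    fix e assume "e \<in> T"
    then have "2 powr real (?d e) \<le> 2 powr r"
      by (simp add: close)
    then show "1 \<le> 2 powr r * (1 / 2) ^ ?d e"
      by (simp add: powr_realpow power_one_over field_simps)
  qed
  also have "\<dots> \<le> (\<Sum>e\<in>signs J. 2 powr r * (1 / 2) ^ ?d e)"
    using fin T by (intro sum_mono2) auto
  also have "\<dots> = 2 powr r * (3 / 2) ^ card J"
    by (simp add: sum_half_power_hamming [OF J e0] flip: sum_distrib_left)
  finally show ?thesis .
qed

section \<open>Partial colouring\<close>

text \<open>It suffices to compare the bases of the two \<open>n\<close>-th powers. Their sixth
  powers have no fractional powers of 2, and
  \<open>2 * (3 / 2) ^ 6 < 23 < 32 \<le> 64 * exp (- 1 / 2)\<close>.\<close>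

lemma hamming_ball_smaller:
  assumes "n \<ge> 1"
  shows "2 powr (real n / 6) * (3 / 2) ^ n < 2 ^ n * exp (- (real n / 12))"
proof -
  define a :: real where "a = 2 powr (1 / 6) * (3 / 2)"
  define b :: real where "b = 2 * exp (- (1 / 12))"
  have "a ^ 6 = (2 powr (1 / 6)) ^ 6 * (3 / 2) ^ 6"
    unfolding a_def by (rule power_mult_distrib)
  also have "(2 powr (1 / 6)) ^ 6 = (2::real)"
    by (simp add: powr_power)
  finally have a6: "a ^ 6 = 2 * (3 / 2) ^ 6" .
  have "b ^ 6 = 64 * exp (- (1 / 2))"
    by (simp add: b_def power_mult_distrib flip: exp_of_nat_mult)
  also have "\<dots> \<ge> 64 * (1 - 1 / 2)"
    using exp_ge_add_one_self [of "- (1 / 2) :: real"] by simp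
  finally have "a ^ 6 < b ^ 6"
    unfolding a6 by (simp add: power_divide)
  then have "a < b"
    by (rule power_less_imp_less_base) (simp add: b_def)
  moreover have "a > 0"
    by (simp add: a_def)
  ultimately have "a ^ n < b ^ n"
    using assms by (intro power_strict_mono) auto
  moreover have "a ^ n = 2 powr (real n / 6) * (3 / 2) ^ n"
    unfolding a_def power_mult_distrib by (simp add: powr_power)
  moreover have "b ^ n = 2 ^ n * exp (- (real n / 12))"
    by (simp add: b_def power_mult_distrib flip: exp_of_nat_mult)
  ultimately show ?thesis by simp
qed

text \<open>Applies \<open>ex_large_fibre\<close> with a product of \<open>geom_weight\<close> laws.
  Letting \<open>\<tau> i\<close> merely dominate the variance keeps it positive even for a zero
  vector.\<close>

lemma ex_far_signs_same_rounding:
  fixes y :: "'i \<Rightarrow> 'a \<Rightarrow> real"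
  assumes I: "finite I" and J: "finite J" "J \<noteq> {}"
    and pos: "\<And>i. i \<in> I \<Longrightarrow> \<tau> i > 0"
    and var: "\<And>i. i \<in> I \<Longrightarrow> (\<Sum>j\<in>J. (y i j)\<^sup>2) \<le> \<tau> i"
    and total: "66 * (\<Sum>i\<in>I. \<tau> i) \<le> real (card J) / 12"
  shows "\<exists>e\<in>signs J. \<exists>e'\<in>signs J. real (card {j \<in> J. e' j \<noteq> e j}) > real (card J) / 6 \<and>
    (\<forall>i\<in>I. round (\<Sum>j\<in>J. e' j * y i j) = round (\<Sum>j\<in>J. e j * y i j))"
proof -
  define s where "s e i = (\<Sum>j\<in>J. e j * y i j)" for e i
  define b where "b e = (\<lambda>i\<in>I. round (s e i))" for e
  define \<eta> where "\<eta> i = min (1 / 2) (\<tau> i)" for i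
  define Q where "Q z = (\<Prod>i\<in>I. geom_weight (\<eta> i) (z i))" for z
  define N :: real where "N = 2 ^ card J"
  have fin: "finite (signs J)" and ne: "signs J \<noteq> {}"
    using J by (simp_all add: finite_PiE PiE_eq_empty_iff)
  have cardN: "real (card (signs J)) = N"
    using J by (simp add: card_signs N_def)
  have \<eta>: "0 < \<eta> i" "\<eta> i < 1" if "i \<in> I" for i
    using pos [OF that] by (auto simp: \<eta>_def)
  have Qb: "Q (b e) = (\<Prod>i\<in>I. geom_weight (\<eta> i) (round (s e i)))" for e
    by (simp add: Q_def b_def)

  \<comment> \<open>Any common bound will do; it confines the rounded values to a finite box, over
    which the sum of \<open>Q\<close> factors.\<close>
  obtain K where K: "\<And>e i. e \<in> signs J \<Longrightarrow> i \<in> I \<Longrightarrow> \<bar>round (s e i)\<bar> \<le> int K"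
  proof
    fix e i assume "e \<in> signs J" "i \<in> I"
    then have "nat \<bar>round (s e i)\<bar> \<le> (\<Sum>(e, i)\<in>signs J \<times> I. nat \<bar>round (s e i)\<bar>)"
      using fin I member_le_sum [of "(e, i)" "signs J \<times> I" "\<lambda>(e, i). nat \<bar>round (s e i)\<bar>"] by auto
    then show "\<bar>round (s e i)\<bar> \<le> int (\<Sum>(e, i)\<in>signs J \<times> I. nat \<bar>round (s e i)\<bar>)"
      by linarith
  qed
  have sub: "(\<Sum>z\<in>b ` signs J. Q z) \<le> 1"
  proof -
    let ?R = "{- int K..int K}"
    have "(\<Sum>z\<in>b ` signs J. Q z) \<le> (\<Sum>z\<in>I \<rightarrow>\<^sub>E ?R. Q z)"
    proof (rule sum_mono2)
      show "b ` signs J \<subseteq> I \<rightarrow>\<^sub>E ?R"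
        using K by (auto simp: b_def abs_le_iff) (metis minus_le_iff)
      show "0 \<le> Q z" for z
        unfolding Q_def using \<eta> by (intro prod_nonneg) (simp add: geom_weight_pos less_imp_le)
    qed (use I in \<open>simp add: finite_PiE\<close>)
    also have "\<dots> = (\<Prod>i\<in>I. \<Sum>k\<in>?R. geom_weight (\<eta> i) k)"
      unfolding Q_def using I by (subst prod_sum_PiE) auto
    also have "\<dots> \<le> 1"
      using \<eta> by (intro prod_le_1 conjI sum_nonneg sum_geom_weight_le_1)
        (auto intro: less_imp_le geom_weight_pos)
    finally show ?thesis .
  qed

  have cost_i: "(\<Sum>e\<in>signs J. - ln (geom_weight (\<eta> i) (round (s e i)))) \<le> N * (66 * \<tau> i)"
    if i: "i \<in> I" for i
  proof -
    let ?A = "\<Sum>j\<in>J. (y i j)\<^sup>2"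
    have "(\<Sum>e\<in>signs J. - ln (geom_weight (\<eta> i) (round (s e i))))
        \<le> (\<Sum>e\<in>signs J. 2 * \<tau> i + 16 * s e i ^ 4 / \<tau> i + 16 * (s e i)\<^sup>2)"
      unfolding \<eta>_def by (intro sum_mono neg_ln_geom_weight_round_le pos i)
    also have "\<dots> = N * (2 * \<tau> i) + 16 / \<tau> i * (\<Sum>e\<in>signs J. s e i ^ 4)
        + 16 * (\<Sum>e\<in>signs J. (s e i)\<^sup>2)"
      by (simp add: sum.distrib cardN sum_distrib_left)
    \<comment> \<open>The fourth moment is quadratic in \<open>\<tau> i\<close>, which cancels the
      division by \<open>\<tau> i\<close>. The constant is
      \<open>2 + 16 * 3 + 16 = 66\<close>.\<close>
    also have "\<dots> \<le> N * (2 * \<tau> i) + 16 / \<tau> i * (N * (3 * (\<tau> i)\<^sup>2)) + 16 * (N * \<tau> i)"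
    proof (intro add_mono mult_left_mono order_refl)
      have "(\<Sum>e\<in>signs J. s e i ^ 4) \<le> N * (3 * ?A\<^sup>2)"
        unfolding s_def N_def using J(1) by (rule rademacher_fourth_moment)
      also have "\<dots> \<le> N * (3 * (\<tau> i)\<^sup>2)"
        using var [OF i] by (intro mult_left_mono power_mono) (auto simp: N_def sum_nonneg)
      finally show "(\<Sum>e\<in>signs J. s e i ^ 4) \<le> N * (3 * (\<tau> i)\<^sup>2)" .
      show "(\<Sum>e\<in>signs J. (s e i)\<^sup>2) \<le> N * \<tau> i"
        using var [OF i] by (simp add: s_def rademacher_second_moment [OF J(1)] N_def)
    qed (use pos [OF i] in \<open>auto simp: N_def\<close>)
    also have "\<dots> = N * (66 * \<tau> i)"
      using pos [OF i] by (simp add: field_simps power2_eq_square)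
    finally show ?thesis .
  qed
  have "(\<Sum>e\<in>signs J. - ln (Q (b e)))
      = (\<Sum>e\<in>signs J. \<Sum>i\<in>I. - ln (geom_weight (\<eta> i) (round (s e i))))"
    unfolding Qb sum_negf
    by (intro arg_cong [of _ _ uminus] sum.cong refl ln_prod) (simp_all add: I \<eta> geom_weight_pos less_imp_neq [symmetric])
  also have "\<dots> = (\<Sum>i\<in>I. \<Sum>e\<in>signs J. - ln (geom_weight (\<eta> i) (round (s e i))))"
    by (rule sum.swap)
  also have "\<dots> \<le> (\<Sum>i\<in>I. N * (66 * \<tau> i))"
    by (intro sum_mono cost_i)
  also have "\<dots> = N * (66 * (\<Sum>i\<in>I. \<tau> i))"
    by (simp add: sum_distrib_left)
  also have "\<dots> \<le> N * (real (card J) / 12)"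
    using total by (intro mult_left_mono) (auto simp: N_def)
  finally have cost: "(\<Sum>e\<in>signs J. - ln (Q (b e))) \<le> real (card (signs J)) * (real (card J) / 12)"
    by (simp add: cardN)

  have Qpos: "Q (b e) > 0" for e
    unfolding Qb using \<eta> by (intro prod_pos) (simp add: geom_weight_pos)
  obtain e where e: "e \<in> signs J"
    and large: "N * exp (- (real (card J) / 12)) \<le> real (card {e' \<in> signs J. b e' = b e})"
    using ex_large_fibre [where Q = Q and b = b, OF fin ne Qpos sub cost] unfolding cardN by blast
  \<comment> \<open>Otherwise the whole fibre would lie in the Hamming ball of radius
    \<open>card J / 6\<close> about \<open>e\<close>, which is too small to hold it.\<close>
  have "\<exists>e'\<in>{e' \<in> signs J. b e' = b e}. real (card {j \<in> J. e' j \<noteq> e j}) > real (card J) / 6"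
  proof (rule ccontr)
    assume "\<not> ?thesis"
    then have "real (card {e' \<in> signs J. b e' = b e}) \<le> 2 powr (real (card J) / 6) * (3 / 2) ^ card J"
      by (intro card_hamming_ball_le [OF J(1) e]) (auto simp: not_less)
    also have "\<dots> < N * exp (- (real (card J) / 12))"
      unfolding N_def using J by (intro hamming_ball_smaller) (simp add: Suc_le_eq card_gt_0_iff)
    finally show False
      using large by simp
  qed
  then obtain e' where e': "e' \<in> signs J" "b e' = b e"
    "real (card {j \<in> J. e' j \<noteq> e j}) > real (card J) / 6"
    by blast
  have "round (s e' i) = round (s e i)" if "i \<in> I" for i
    using fun_cong [OF e'(2), of i] that by (simp add: b_def)
  then show ?thesis
    using e e' unfolding s_def by blast
qed

lemma partial_colouring:
  fixes x :: "nat \<Rightarrow> nat \<Rightarrow> real"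
  assumes m: "m \<ge> 1" and n: "n \<ge> 1"
    and norm: "(\<Sum>i = 1..m. (L2_set (x i) {1..n})\<^sup>2) \<le> real m"
  shows "\<exists>\<epsilon>. (\<forall>j\<in>{1..n}. \<epsilon> j \<in> {-1, 0, 1}) \<and> l1_norm n \<epsilon> \<ge> real n / 6 \<and>
    (\<forall>i\<in>{1..m}. \<bar>inner_prod n \<epsilon> (x i)\<bar> \<le> 20 * sqrt (real m / real n))"
proof -
  define \<delta> where "\<delta> = 20 * sqrt (real m / real n)"
  \<comment> \<open>The \<open>+ 1\<close> makes \<open>\<tau> i\<close> positive and adds only
    \<open>m\<close> to the sum of squared norms, which is already allowed to reach
    \<open>m\<close>.\<close>
  define \<tau> where "\<tau> i = ((L2_set (x i) {1..n})\<^sup>2 + 1) / (2 * \<delta>)\<^sup>2" for i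
  have \<delta>: "\<delta> > 0"
    using m n by (simp add: \<delta>_def)
  have \<delta>2: "(2 * \<delta>)\<^sup>2 = 1600 * (real m / real n)"
    by (simp add: \<delta>_def power_mult_distrib)
  have L2: "(L2_set (x i) {1..n})\<^sup>2 = (\<Sum>j = 1..n. (x i j)\<^sup>2)" for i
    by (simp add: L2_set_def sum_nonneg)
  have pos: "\<tau> i > 0" for i
    using \<delta> by (simp add: \<tau>_def add_nonneg_pos)
  have var: "(\<Sum>j = 1..n. (x i j / (2 * \<delta>))\<^sup>2) \<le> \<tau> i" for i
    unfolding \<tau>_def L2 power_divide sum_divide_distrib [symmetric]
    by (intro divide_right_mono) auto
  have "(\<Sum>i = 1..m. \<tau> i) = ((\<Sum>i = 1..m. (L2_set (x i) {1..n})\<^sup>2) + real m) / (2 * \<delta>)\<^sup>2"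
    by (simp add: \<tau>_def sum.distrib flip: sum_divide_distrib)
  also have "\<dots> \<le> (real m + real m) / (2 * \<delta>)\<^sup>2"
    using norm by (intro divide_right_mono) auto
  \<comment> \<open>This fixes the constant 20: \<open>(2 * 20)^2 = 1600\<close>, and
    \<open>66 / 800 \<le> 66 / 792 = 1 / 12\<close>.\<close>
  also have "\<dots> = real n / 800"
    unfolding \<delta>2 using m n by (simp add: field_simps)
  finally have total: "66 * (\<Sum>i = 1..m. \<tau> i) \<le> real (card {1..n}) / 12"
    by simp
  obtain e e' where e: "e \<in> signs {1..n}" "e' \<in> signs {1..n}"
    and far: "real (card {j \<in> {1..n}. e' j \<noteq> e j}) > real n / 6"
    and same: "\<And>i. i \<in> {1..m} \<Longrightarrow>
      round (\<Sum>j = 1..n. e' j * (x i j / (2 * \<delta>))) = round (\<Sum>j = 1..n. e j * (x i j / (2 * \<delta>)))"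
    using ex_far_signs_same_rounding [where I = "{1..m}" and J = "{1..n}" and \<tau> = \<tau>
        and y = "\<lambda>i j. x i j / (2 * \<delta>)", OF _ _ _ pos var total] n
    by auto
  define \<epsilon> where "\<epsilon> j = (e' j - e j) / 2" for j
  have val: "\<epsilon> j \<in> {-1, 0, 1}" "\<bar>\<epsilon> j\<bar> = (if e' j \<noteq> e j then 1 else 0)" if "j \<in> {1..n}" for j
  proof -
    have "e j = -1 \<or> e j = 1" "e' j = -1 \<or> e' j = 1"
      using e that by (auto simp: PiE_iff)
    then show "\<epsilon> j \<in> {-1, 0, 1}" "\<bar>\<epsilon> j\<bar> = (if e' j \<noteq> e j then 1 else 0)"
      by (auto simp: \<epsilon>_def)
  qed
  have "l1_norm n \<epsilon> = (\<Sum>j = 1..n. if e' j \<noteq> e j then 1 else 0)"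
    unfolding l1_norm_def by (intro sum.cong val refl)
  also have "\<dots> = real (card {j \<in> {1..n}. e' j \<noteq> e j})"
    by (simp add: sum.If_cases Int_def)
  finally have "l1_norm n \<epsilon> \<ge> real n / 6"
    using far by simp
  moreover have "\<bar>inner_prod n \<epsilon> (x i)\<bar> \<le> \<delta>" if "i \<in> {1..m}" for i
  proof -
    \<comment> \<open>The half in \<open>\<epsilon>\<close> matches the scale
      \<open>2 * \<delta>\<close>: the inner product is \<open>\<delta>\<close> times a difference
      of two reals with the same rounding, which differ by at most 1.\<close>
    have "inner_prod n \<epsilon> (x i)
        = \<delta> * ((\<Sum>j = 1..n. e' j * (x i j / (2 * \<delta>))) - (\<Sum>j = 1..n. e j * (x i j / (2 * \<delta>))))"
      unfolding inner_prod_def sum_subtractf [symmetric] sum_distrib_left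
      using \<delta> by (intro sum.cong) (auto simp: \<epsilon>_def field_simps)
    then show ?thesis
      using round_eq_imp_diff_1 [OF same [OF that]] \<delta>
      by (simp add: abs_mult mult_left_le)
  qed
  ultimately show ?thesis
    using val(1) unfolding \<delta>_def by blast
qed

theorem theorem1:
  shows "\<exists>c::real. c > 0 \<and>
    (\<forall>(m::nat) (n::nat) (x :: nat \<Rightarrow> nat \<Rightarrow> real).
      m \<ge> 1 \<longrightarrow> n \<ge> 1 \<longrightarrow>
      (\<Sum>i = 1..m. (L2_set (x i) {1..n})\<^sup>2) \<le> real m \<longrightarrow>
      (\<exists>\<epsilon> :: nat \<Rightarrow> real.
        (\<forall>j\<in>{1..n}. \<epsilon> j \<in> {-1, 0, 1}) \<and>
        l1_norm n \<epsilon> \<ge> real n / 6 \<and>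
        Max ((\<lambda>i. \<bar>inner_prod n \<epsilon> (x i)\<bar>) ` {1..m}) \<le> c * sqrt (real m / real n)))"
proof (intro exI [of _ "20::real"] conjI allI impI)
  fix m n :: nat and x :: "nat \<Rightarrow> nat \<Rightarrow> real"
  assume "m \<ge> 1" "n \<ge> 1" "(\<Sum>i = 1..m. (L2_set (x i) {1..n})\<^sup>2) \<le> real m"
  then obtain \<epsilon> where "\<forall>j\<in>{1..n}. \<epsilon> j \<in> {-1, 0, 1}" "l1_norm n \<epsilon> \<ge> real n / 6"
    "\<forall>i\<in>{1..m}. \<bar>inner_prod n \<epsilon> (x i)\<bar> \<le> 20 * sqrt (real m / real n)"
    using partial_colouring by blast
  then show "\<exists>\<epsilon>. (\<forall>j\<in>{1..n}. \<epsilon> j \<in> {-1, 0, 1}) \<and> l1_norm n \<epsilon> \<ge> real n / 6 \<and>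
      Max ((\<lambda>i. \<bar>inner_prod n \<epsilon> (x i)\<bar>) ` {1..m}) \<le> 20 * sqrt (real m / real n)"
    \<comment> \<open>Here \<open>m \<ge> 1\<close> makes the index set nonempty, so
      \<open>Max\<close> is a true maximum.\<close>
    using \<open>m \<ge> 1\<close> by (intro exI [of _ \<epsilon>]) (simp add: Max_le_iff)
qed simp

end
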